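(* Let $\mathcal{X}$ be a real normed linear space (which is convex), and let $\mathbf{F}: \mathcal{X} \to I(\mathbb{R})$ be an interval-valued function that is convex on $\mathcal{X}$ and $gH$-Lipschitz continuous at some $\bar{x} \in \mathcal{X}$. Then, for every direction $h\in\mathcal{X}$, the upper $gH$-Clarke derivative of $\mathbf{F}$ at $\bar{x}$ in the direction $h$ coincides with the $gH$-directional derivative of $\mathbf{F}$ at $\bar{x}$ in the direction $h$, i.e. $\mathbf{F}_{\mathscr{C}}(\bar{x})(h)=\mathbf{F}_{\mathscr{D}}(\bar{x})(h)$.
   Context: $I(\mathbb{R})$ is the set of closed bounded intervals $\mathbf{A}=[\underline{a},\overline{a}]$ with $\underline{a}\le\overline{a}$ real. An interval-valued function (IVF) is a map into $I(\mathbb{R})$, written $\mathbf{F}(x)=[\underline{f}(x),\overline{f}(x)]$. $\mathbf{A}\oplus\mathbf{B}=[\underline{a}+\underline{b},\overline{a}+\overline{b}]$. For $\lambda\ge 0$, $\lambda\odot\mathbf{A}=[\lambda\underline{a},\lambda\overline{a}]$; for $\lambda<0$, $\lambda\odot\mathbf{A}=[\lambda\overline{a},\lambda\underline{a}]$. $gH$-difference: $\mathbf{A}\ominus_{gH}\mathbf{B}=[\min\{\underline{a}-\underline{b},\overline{a}-\overline{b}\},\max\{\underline{a}-\underline{b},\overline{a}-\overline{b}\}]$. Order: $\mathbf{A}\preceq\mathbf{B}$ means $\underline{a}\le\underline{b}$ and $\overline{a}\le\overline{b}$. Norm: $\lVert\mathbf{A}\rVert_{I(\mathbb{R})}=\max\{|\underline{a}|,|\overline{a}|\}$.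 $\mathcal{B}(\bar{x},\delta)$ is the open ball of radius $\delta$ centered at $\bar{x}$, and $\overline{\mathcal{B}}(\bar{x},\delta)=\mathcal{B}(\bar{x},\delta)\setminus\{\bar{x}\}$. $\mathbf{F}$ is convex on a convex set $\mathcal{S}$ if $\mathbf{F}(\lambda_1x_1+\lambda_2x_2)\preceq\lambda_1\odot\mathbf{F}(x_1)\oplus\lambda_2\odot\mathbf{F}(x_2)$ for all $x_1,x_2\in\mathcal{S}$ and $\lambda_1,\lambda_2\in[0,1]$ with $\lambda_1+\lambda_2=1$. $\mathbf{F}:\mathcal{S}\to I(\mathbb{R})$ is $gH$-Lipschitz continuous at $\bar{x}\in\mathcal{S}$ if there exist $K'>0$ and $\delta>0$ with $\lVert\mathbf{F}(\bar{x})\ominus_{gH}\mathbf{F}(y)\rVert_{I(\mathbb{R})}\le K'\lVert\bar{x}-y\rVert$ for all $y\in\mathcal{S}\cap\mathcal{B}(\bar{x},\delta)$. Limits and suprema of intervals are taken endpointwise. The $gH$-directional derivative of $\mathbf{F}$ at $\bar{x}$ in the direction $h$ is $$\mathbf{F}_{\mathscr{D}}(\bar{x})(h)=\lim_{\lambda\to0+}\frac1\lambda\odot\big(\mathbf{F}(\bar{x}+\lambda h)\ominus_{gH}\mathbf{F}(\bar{x})\big),$$ when it exists finitely. The upper $gH$-Clarke derivative of $\mathbf{F}$ (here with domain $\mathcal{S}=\mathcal{X}$) at $\bar{x}$ in the direction $h$ is $$\mathbf{F}_{\mathscr{C}}(\bar{x})(h)=\lim_{\delta\to0}\Big(\sup_{x\in\overline{\mathcal{B}}(\bar{x},\delta)\cap\mathcal{S},\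 \lambda\in(0,\delta)}\frac1\lambda\odot\big(\mathbf{F}(x+\lambda h)\ominus_{gH}\mathbf{F}(x)\big)\Big),$$ when it exists finitely. *)

theory Defs
  imports "HOL-Analysis.Analysis" "HOL-Library.Interval"
begin

text \<open>
  Intervals are elements of the library type \<^typ>\<open>real interval\<close>, and interval addition is the
  library's \<open>+\<close>. Three other library notions on this type are deliberately not used: \<open>\<le>\<close> is
  inclusion, \<open>-\<close> is the Minkowski difference, and the topology involves values of
  \<open>Interval (a, b)\<close> with \<open>a > b\<close>, so it is not obviously that of endpointwise convergence.
\<close>

definition iscale :: "real \<Rightarrow> real interval \<Rightarrow> real interval" (infixr \<open>\<odot>\<close> 75)
  where "c \<odot> A = (if c \<ge> 0 then Interval (c * lower A, c * upper A)
                 else Interval (c * upper A, c * lower A))"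

definition gH_diff :: "real interval \<Rightarrow> real interval \<Rightarrow> real interval" (infixl \<open>\<ominus>\<^sub>g\<^sub>H\<close> 65)
  where "A \<ominus>\<^sub>g\<^sub>H B = Interval (min (lower A - lower B) (upper A - upper B),
                          max (lower A - lower B) (upper A - upper B))"

definition iprec :: "real interval \<Rightarrow> real interval \<Rightarrow> bool" (infix \<open>\<preceq>\<^sub>I\<close> 50)
  where "A \<preceq>\<^sub>I B \<longleftrightarrow> lower A \<le> lower B \<and> upper A \<le> upper B"

definition inorm :: "real interval \<Rightarrow> real"
  where "inorm A = max \<bar>lower A\<bar> \<bar>upper A\<bar>"

lemma lower_Interval: "a \<le> b \<Longrightarrow> lower (Interval (a, b)) = a"
  by (simp add: lower.rep_eq Interval_inverse)

lemma upper_Interval: "a \<le> b \<Longrightarrow> upper (Interval (a, b)) = b"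
  by (simp add: upper.rep_eq Interval_inverse)

lemma lower_iscale: "lower (c \<odot> A) = (if c \<ge> 0 then c * lower A else c * upper A)"
  by (simp add: iscale_def lower_Interval mult_left_mono mult_left_mono_neg)

lemma upper_iscale: "upper (c \<odot> A) = (if c \<ge> 0 then c * upper A else c * lower A)"
  by (simp add: iscale_def upper_Interval mult_left_mono mult_left_mono_neg)

lemma lower_gH_diff: "lower (A \<ominus>\<^sub>g\<^sub>H B) = min (lower A - lower B) (upper A - upper B)"
  by (simp add: gH_diff_def lower_Interval mult_left_mono mult_left_mono_neg)

lemma upper_gH_diff: "upper (A \<ominus>\<^sub>g\<^sub>H B) = max (lower A - lower B) (upper A - upper B)"
  by (simp add: gH_diff_def upper_Interval mult_left_mono mult_left_mono_neg)

definition ivf_convex_on :: "'a::real_vector set \<Rightarrow> ('a \<Rightarrow> real interval) \<Rightarrow> bool"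
  where "ivf_convex_on S F \<longleftrightarrow> convex S \<and>
    (\<forall>x1\<in>S. \<forall>x2\<in>S. \<forall>l1\<in>{0..1}. \<forall>l2\<in>{0..1}. l1 + l2 = 1 \<longrightarrow>
      F (l1 *\<^sub>R x1 + l2 *\<^sub>R x2) \<preceq>\<^sub>I l1 \<odot> F x1 + l2 \<odot> F x2)"

definition gH_Lipschitz_at ::
    "'a::real_normed_vector set \<Rightarrow> ('a \<Rightarrow> real interval) \<Rightarrow> 'a \<Rightarrow> bool"
  where "gH_Lipschitz_at S F xb \<longleftrightarrow> xb \<in> S \<and>
    (\<exists>K>0. \<exists>\<delta>>0. \<forall>y\<in>S \<inter> ball xb \<delta>. inorm (F xb \<ominus>\<^sub>g\<^sub>H F y) \<le> K * norm (xb - y))"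

definition gH_quotient ::
    "('a::real_vector \<Rightarrow> real interval) \<Rightarrow> 'a \<Rightarrow> 'a \<Rightarrow> real \<Rightarrow> real interval"
  where "gH_quotient F h x t = (1 / t) \<odot> (F (x + t *\<^sub>R h) \<ominus>\<^sub>g\<^sub>H F x)"

text \<open>
  As for \<open>has_derivative\<close>, each of the next two relations expresses that the derivative exists
  (finitely) and equals \<open>L\<close>.
\<close>

definition has_gH_directional_derivative ::
    "('a::real_normed_vector \<Rightarrow> real interval) \<Rightarrow> 'a \<Rightarrow> 'a \<Rightarrow> real interval \<Rightarrow> bool"
  where "has_gH_directional_derivative F xb h L \<longleftrightarrow>
    ((\<lambda>t. lower (gH_quotient F h xb t)) \<longlongrightarrow> lower L) (at_right 0) \<and>
    ((\<lambda>t. upper (gH_quotient F h xb t)) \<longlongrightarrow> upper L) (at_right 0)"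

text \<open>
  The suprema are taken in the extended reals: for a given \<open>\<delta>\<close> they may be infinite, whereas \<open>Sup\<close>
  of an unbounded (or empty) set of reals is an unspecified real number.
\<close>

definition has_upper_gH_Clarke_derivative ::
    "('a::real_normed_vector \<Rightarrow> real interval) \<Rightarrow> 'a \<Rightarrow> 'a \<Rightarrow> real interval \<Rightarrow> bool"
  where "has_upper_gH_Clarke_derivative F xb h L \<longleftrightarrow>
    ((\<lambda>\<delta>. SUP (x, t)\<in>(ball xb \<delta> - {xb}) \<times> {0<..<\<delta>}. ereal (lower (gH_quotient F h x t)))
      \<longlongrightarrow> ereal (lower L)) (at_right 0) \<and>
    ((\<lambda>\<delta>. SUP (x, t)\<in>(ball xb \<delta> - {xb}) \<times> {0<..<\<delta>}. ereal (upper (gH_quotient F h x t)))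
      \<longlongrightarrow> ereal (upper L)) (at_right 0)"

lemma has_gH_directional_derivative_unique:
  assumes "has_gH_directional_derivative F xb h L" "has_gH_directional_derivative F xb h M"
  shows "L = M"
  using assms unfolding has_gH_directional_derivative_def interval_eq_iff
  by (meson tendsto_unique trivial_limit_at_right_real)

lemma has_upper_gH_Clarke_derivative_unique:
  assumes "has_upper_gH_Clarke_derivative F xb h L" "has_upper_gH_Clarke_derivative F xb h M"
  shows "L = M"
proof -
  have "ereal (lower L) = ereal (lower M)" "ereal (upper L) = ereal (upper M)"
    using assms unfolding has_upper_gH_Clarke_derivative_def
    by (meson tendsto_unique trivial_limit_at_right_real)+
  then show ?thesis
    by (simp add: interval_eq_iff)
qed

end

theory Submission
  imports Defs
begin

text \<open>
  Convexity makes the difference quotients of both endpoint functions nondecreasing in the step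
  length, and together with boundedness near \<open>xb\<close> it makes the endpoint functions continuous near
  \<open>xb\<close>. Both properties, and the convergence of the quotients at \<open>xb\<close>, pass to the minimum and
  the maximum of the two quotients, which are the endpoints of the interval quotient. For a
  quotient \<open>q\<close> with these properties, the supremum over \<open>(x, t)\<close> near \<open>(xb, 0)\<close> is at most
  \<open>sup\<^sub>x q x s\<close> for a fixed small \<open>s\<close>, hence close to \<open>q xb s\<close>; conversely it is at least
  \<open>q xb t\<close> for small \<open>t\<close>, by continuity in \<open>x\<close>.
\<close>

text \<open>For \<open>v \<noteq> 0\<close> the points \<open>x + t *\<^sub>R v\<close> tend to
  \<open>x\<close> without meeting it as \<open>t\<close> decreases to 0. This makes limits along
  \<open>at xb\<close> informative, as the punctured balls in the Clarke supremum require.\<close>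

lemma at_neq_bot_if_nontrivial:
  fixes x :: "'a::real_normed_vector"
  assumes "(UNIV :: 'a set) \<noteq> {0}"
  shows "at x \<noteq> bot"
proof -
  obtain v :: 'a where v: "v \<noteq> 0"
    using assms by auto
  have "((\<lambda>t. x + t *\<^sub>R v) \<longlongrightarrow> x + 0 *\<^sub>R v) (at_right 0)"
    by (intro tendsto_intros)
  moreover have "\<forall>\<^sub>F t in at_right (0::real). x + t *\<^sub>R v \<noteq> x"
    using eventually_at_right_less[of "0::real"] by eventually_elim (use v in auto)
  ultimately have "filterlim (\<lambda>t. x + t *\<^sub>R v) (at x) (at_right (0::real))"
    by (simp add: filterlim_at)
  then have "filtermap (\<lambda>t. x + t *\<^sub>R v) (at_right (0::real)) \<le> at x"
    by (simp add: filterlim_def)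
  then show ?thesis
    by (metis bot.extremum_uniqueI filtermap_bot_iff trivial_limit_at_right_real)
qed

text \<open>Kept abstract in \<open>q\<close> so that it serves both endpoints of
  \<open>gH_quotient\<close>. Monotonicity is asked at every \<open>x\<close>, since the supremum
  moves the base point; continuity is asked at \<open>xb\<close> only.\<close>

lemma tendsto_SUP_mono_quotient:
  fixes q :: "'a::real_normed_vector \<Rightarrow> real \<Rightarrow> real"
  assumes nontrivial: "(UNIV :: 'a set) \<noteq> {0}"
    and mono: "\<And>x. mono_on {0<..} (q x)"
    and cont: "\<forall>\<^sub>F t in at_right 0. isCont (\<lambda>x. q x t) xb"
    and lim: "(q xb \<longlongrightarrow> L) (at_right 0)"
  shows "((\<lambda>\<delta>. SUP (x, t)\<in>(ball xb \<delta> - {xb}) \<times> {0<..<\<delta>}. ereal (q x t))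
            \<longlongrightarrow> ereal L) (at_right 0)"
    (is "(?S \<longlongrightarrow> _) _")
proof (rule order_tendstoI)
  fix a assume a: "a < ereal L"
  \<comment> \<open>A nondecreasing quotient stays above its right-hand limit at 0.\<close>
  have L_le: "L \<le> q xb t" if "t > 0" for t
  proof (rule tendsto_upperbound[OF lim])
    show "\<forall>\<^sub>F s in at_right 0. q xb s \<le> q xb t"
      using eventually_at_right_real[OF that]
      by eventually_elim (use that mono in \<open>auto simp: monotone_on_def\<close>)
  qed simp
  \<comment> \<open>The supremum omits \<open>x = xb\<close>, so \<open>q xb t\<close> is reached
    only as the limit of the admissible values \<open>q x t\<close> along
    \<open>at xb\<close>.\<close>
  have "ereal L \<le> ?S d" if "d > 0" for d
  proof -
    have "\<forall>\<^sub>F t in at_right 0. t \<in> {0<..<d} \<and> isCont (\<lambda>x. q x t) xb"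
      using eventually_at_right_real[OF that] cont by eventually_elim auto
    then obtain t where t: "t \<in> {0<..<d}" and "isCont (\<lambda>x. q x t) xb"
      using eventually_happens' trivial_limit_at_right_real by blast
    then have "((\<lambda>x. ereal (q x t)) \<longlongrightarrow> ereal (q xb t)) (at xb)"
      by (simp add: isCont_def)
    moreover have "\<forall>\<^sub>F x in at xb. ereal (q x t) \<le> ?S d"
    proof -
      have "\<forall>\<^sub>F x in at xb. x \<in> ball xb d - {xb}"
        using that by (intro eventually_at_in_open) auto
      then show ?thesis
        by eventually_elim (rule SUP_upper2[of "(_, t)"], use t in auto)
    qed
    ultimately have "ereal (q xb t) \<le> ?S d"
      using at_neq_bot_if_nontrivial[OF nontrivial] by (rule tendsto_upperbound)
    moreover have "L \<le> q xb t"
      using L_le t by simp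
    ultimately show ?thesis
      by (meson ereal_less_eq(3) order_trans)
  qed
  then have "a < ?S d" if "d > 0" for d
    using a that less_le_trans by blast
  then show "\<forall>\<^sub>F d in at_right 0. a < ?S d"
    using eventually_at_right_less[of "0::real"] by (auto elim!: eventually_mono)
next
  fix a assume "ereal L < a"
  \<comment> \<open>The intermediate \<open>b\<close> keeps the final inequality strict: a supremum
    of values below \<open>b\<close> is only known to be at most \<open>b\<close>.\<close>
  then obtain b where b: "ereal L < ereal b" "ereal b < a"
    using ereal_dense2 by blast
  then have "\<forall>\<^sub>F s in at_right 0. q xb s < b"
    using lim by (auto intro: order_tendstoD)
  then have "\<forall>\<^sub>F s in at_right 0. 0 < s \<and> q xb s < b \<and> isCont (\<lambda>x. q x s) xb"
    using cont eventually_at_right_less[of "0::real"] by eventually_elim auto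
  then obtain s where s: "s > 0" "q xb s < b" "isCont (\<lambda>x. q x s) xb"
    using eventually_happens' trivial_limit_at_right_real by blast
  then have "\<forall>\<^sub>F x in at xb. q x s < b"
    by (auto simp: isCont_def intro: order_tendstoD)
  then obtain r where r: "r > 0" "\<And>x. x \<in> ball xb r - {xb} \<Longrightarrow> q x s < b"
    by (auto simp: eventually_at dist_commute)
  \<comment> \<open>\<open>d < r\<close> places \<open>x\<close> where \<open>q x s < b\<close>, and
    \<open>d < s\<close> lets monotonicity replace every step \<open>t\<close> by the fixed step
    \<open>s\<close>.\<close>
  have "?S d < a" if d: "d \<in> {0<..<min r s}" for d
  proof -
    have "q x t \<le> b" if "x \<in> ball xb d - {xb}" "t \<in> {0<..<d}" for x t
    proof -
      have "q x t \<le> q x s"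
        using mono[of x] that d s(1) by (auto simp: monotone_on_def)
      also have "\<dots> < b"
        using that d by (intro r) auto
      finally show ?thesis by simp
    qed
    then have "(case z of (x, t) \<Rightarrow> ereal (q x t)) \<le> ereal b"
      if "z \<in> (ball xb d - {xb}) \<times> {0<..<d}" for z
      using that by (cases z) (simp only: mem_Sigma_iff case_prod_conv ereal_less_eq)
    then have "?S d \<le> ereal b"
      by (rule SUP_least)
    then show ?thesis
      using b by (rule_tac le_less_trans)
  qed
  moreover have "\<forall>\<^sub>F d in at_right 0. d \<in> {0<..<min r s}"
    using r(1) s(1) by (intro eventually_at_right_real) simp
  ultimately show "\<forall>\<^sub>F d in at_right 0. ?S d < a"
    by (auto elim: eventually_mono)
qed

text \<open>For \<open>t \<le> s\<close>, the point \<open>x + t *\<^sub>R h\<close> divides the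
  segment from \<open>x\<close> to \<open>x + s *\<^sub>R h\<close> with weight
  \<open>t / s\<close>.\<close>

lemma convex_on_quotient_mono:
  fixes f :: "'a::real_vector \<Rightarrow> real"
  assumes "convex_on UNIV f"
  shows "mono_on {0<..} (\<lambda>t. (f (x + t *\<^sub>R h) - f x) / t)"
proof (rule mono_onI)
  fix t s :: real
  assume ts: "t \<in> {0<..}" "s \<in> {0<..}" "t \<le> s"
  have eq: "(1 - t / s) *\<^sub>R x + (t / s) *\<^sub>R (x + s *\<^sub>R h) = x + t *\<^sub>R h"
    using ts by (simp add: algebra_simps)
  have "f ((1 - t / s) *\<^sub>R x + (t / s) *\<^sub>R (x + s *\<^sub>R h)) \<le>
        (1 - t / s) * f x + (t / s) * f (x + s *\<^sub>R h)"
    using ts by (intro convex_onD[OF assms]) auto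
  also have "\<dots> = f x + t * ((f (x + s *\<^sub>R h) - f x) / s)"
    using ts by (simp add: field_simps)
  finally have "f (x + t *\<^sub>R h) - f x \<le> t * ((f (x + s *\<^sub>R h) - f x) / s)"
    unfolding eq by linarith
  then show "(f (x + t *\<^sub>R h) - f x) / t \<le> (f (x + s *\<^sub>R h) - f x) / s"
    using ts by (simp add: pos_divide_le_eq mult.commute)
qed

text \<open>The quotient is monotone, so a lower bound suffices; the backward difference
  \<open>f x - f (x - h)\<close> is one.\<close>

lemma convex_on_directional_derivative_exists:
  fixes f :: "'a::real_vector \<Rightarrow> real"
  assumes "convex_on UNIV f"
  shows "\<exists>L. ((\<lambda>t. (f (x + t *\<^sub>R h) - f x) / t) \<longlongrightarrow> L) (at_right 0)"
proof -
  let ?q = "\<lambda>t. (f (x + t *\<^sub>R h) - f x) / t"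
  have "f x - f (x - h) \<le> ?q t" if "t > 0" for t
  proof -
    \<comment> \<open>Chosen to solve \<open>(1 - c) * t = c\<close>, which makes \<open>x\<close>
      the convex combination of \<open>x + t *\<^sub>R h\<close> and \<open>x - h\<close> with
      weights \<open>1 - c\<close> and \<open>c\<close>.\<close>
    define c where "c = t / (1 + t)"
    have c: "0 \<le> c" "c \<le> 1" "1 - c = 1 / (1 + t)"
      using that by (auto simp: c_def field_simps)
    have "(1 - c) *\<^sub>R (x + t *\<^sub>R h) + c *\<^sub>R (x - h) = x + ((1 - c) * t - c) *\<^sub>R h"
      by (simp add: algebra_simps)
    also have "(1 - c) * t - c = 0"
      unfolding c(3) by (simp add: c_def)
    finally have "f x \<le> (1 - c) * f (x + t *\<^sub>R h) + c * f (x - h)"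
      using convex_onD[OF assms c(1,2), of "x + t *\<^sub>R h" "x - h"] by simp
    also have "\<dots> = (f (x + t *\<^sub>R h) + t * f (x - h)) / (1 + t)"
      unfolding c(3) by (simp add: c_def add_divide_distrib)
    finally show ?thesis
      using that by (simp add: field_simps)
  qed
  then have "(?q \<longlongrightarrow> Inf (?q ` ({0<..} \<inter> UNIV))) (at 0 within ({0<..} \<inter> UNIV))"
    using convex_on_quotient_mono[OF assms, of x h]
    by (intro Lim_right_bound) (auto simp: monotone_on_def)
  then show ?thesis
    by auto
qed

text \<open>A convex function bounded on an open ball is continuous there. The restriction to small
  \<open>t\<close> keeps \<open>xb + t *\<^sub>R h\<close> in that ball.\<close>

lemma convex_on_quotient_isCont:
  fixes f :: "'a::real_normed_vector \<Rightarrow> real"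
  assumes conv: "convex_on UNIV f" and "r > 0"
    and bdd: "\<And>y. y \<in> ball xb r \<Longrightarrow> \<bar>f y - f xb\<bar> \<le> B"
  shows "\<forall>\<^sub>F t in at_right 0. isCont (\<lambda>x. (f (x + t *\<^sub>R h) - f x) / t) xb"
proof -
  have "continuous_on (ball xb r) f"
  proof (rule convex_on_bounded_continuous)
    show "convex_on (ball xb r) f"
      using conv by (rule convex_on_subset) auto
    show "\<forall>y\<in>ball xb r. \<bar>f y\<bar> \<le> \<bar>f xb\<bar> + B"
    proof
      fix y assume "y \<in> ball xb r"
      from bdd[OF this] show "\<bar>f y\<bar> \<le> \<bar>f xb\<bar> + B"
        by linarith
    qed
  qed simp
  then have cont: "isCont f y" if "y \<in> ball xb r" for y
    using that continuous_on_eq_continuous_at by blast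
  have "((\<lambda>t. xb + t *\<^sub>R h) \<longlongrightarrow> xb + 0 *\<^sub>R h) (at_right 0)"
    by (intro tendsto_intros)
  then have "\<forall>\<^sub>F t in at_right 0. xb + t *\<^sub>R h \<in> ball xb r"
    using \<open>r > 0\<close> by (intro topological_tendstoD) auto
  then show ?thesis
    using eventually_at_right_less[of "0::real"]
  proof eventually_elim
    case (elim t)
    have "isCont (\<lambda>x. f (x + t *\<^sub>R h)) xb"
      using cont[OF elim(1)] by (rule isCont_o2[rotated]) (intro continuous_intros)
    then show ?case
      using cont[of xb] \<open>r > 0\<close> elim(2) by (intro continuous_intros) auto
  qed
qed

text \<open>Nonnegative weights never swap endpoints under \<open>\<odot>\<close>, so the interval
  inequality splits into two scalar ones.\<close>

lemma ivf_convex_on_endpoints: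
  assumes "ivf_convex_on S F"
  shows "convex_on S (\<lambda>x. lower (F x))" "convex_on S (\<lambda>x. upper (F x))"
proof -
  have S: "convex S"
    using assms by (simp add: ivf_convex_on_def)
  have "F (u *\<^sub>R x + v *\<^sub>R y) \<preceq>\<^sub>I u \<odot> F x + v \<odot> F y"
    if "x \<in> S" "y \<in> S" "0 \<le> u" "0 \<le> v" "u + v = 1" for x y u v
    using assms that by (auto simp: ivf_convex_on_def)
  then show "convex_on S (\<lambda>x. lower (F x))" "convex_on S (\<lambda>x. upper (F x))"
    by (auto simp: convex_on_def S iprec_def lower_iscale upper_iscale)
qed

text \<open>The minimum and maximum of the two endpoint differences are the endpoints of the
  gH-difference, so its norm bounds both differences in absolute value.\<close>

lemma gH_Lipschitz_at_endpoints_bounded: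
  assumes "gH_Lipschitz_at UNIV F xb"
  obtains r B where "r > 0"
    "\<And>y. y \<in> ball xb r \<Longrightarrow> \<bar>lower (F y) - lower (F xb)\<bar> \<le> B"
    "\<And>y. y \<in> ball xb r \<Longrightarrow> \<bar>upper (F y) - upper (F xb)\<bar> \<le> B"
proof -
  obtain K r where Kr: "K > 0" "r > 0"
    and lip: "\<And>y. y \<in> ball xb r \<Longrightarrow> inorm (F xb \<ominus>\<^sub>g\<^sub>H F y) \<le> K * norm (xb - y)"
    using assms by (auto simp: gH_Lipschitz_at_def)
  have "\<bar>lower (F y) - lower (F xb)\<bar> \<le> K * r \<and> \<bar>upper (F y) - upper (F xb)\<bar> \<le> K * r"
    if "y \<in> ball xb r" for y
  proof -
    have "K * norm (xb - y) \<le> K * r"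
      using that Kr by (simp add: dist_norm)
    with lip[OF that] show ?thesis
      by (auto simp: inorm_def lower_gH_diff upper_gH_diff min_def max_def split: if_splits)
  qed
  with Kr(2) that show ?thesis by blast
qed

lemma lower_gH_quotient:
  assumes "t > 0"
  shows "lower (gH_quotient F h x t) =
    min ((lower (F (x + t *\<^sub>R h)) - lower (F x)) / t) ((upper (F (x + t *\<^sub>R h)) - upper (F x)) / t)"
  using assms by (simp add: gH_quotient_def lower_iscale lower_gH_diff min_divide_distrib_right)

lemma upper_gH_quotient:
  assumes "t > 0"
  shows "upper (gH_quotient F h x t) =
    max ((lower (F (x + t *\<^sub>R h)) - lower (F x)) / t) ((upper (F (x + t *\<^sub>R h)) - upper (F x)) / t)"
  using assms by (simp add: gH_quotient_def upper_iscale upper_gH_diff max_divide_distrib_right)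

theorem theorem3p2:
  fixes F :: "'a::real_normed_vector \<Rightarrow> real interval" and xb :: 'a
  assumes "(UNIV :: 'a set) \<noteq> {0}"
    and "ivf_convex_on UNIV F"
    and "gH_Lipschitz_at UNIV F xb"
  shows "\<forall>h. \<exists>L. has_upper_gH_Clarke_derivative F xb h L \<and>
                 has_gH_directional_derivative F xb h L"
proof
  fix h
  \<comment> \<open>Which of \<open>p x t\<close> and \<open>q x t\<close> is smaller may depend on
    \<open>x\<close> and \<open>t\<close>. Hence each property is proved for \<open>p\<close> and
    \<open>q\<close> first and only then transferred to their minimum and maximum.\<close>
  define p where "p x t = (lower (F (x + t *\<^sub>R h)) - lower (F x)) / t" for x t
  define q where "q x t = (upper (F (x + t *\<^sub>R h)) - upper (F x)) / t" for x t
  note conv = ivf_convex_on_endpoints[OF assms(2)]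
  have mono: "mono_on {0<..} (p x)" "mono_on {0<..} (q x)" for x
    unfolding p_def q_def by (intro convex_on_quotient_mono conv)+
  obtain l u where lim: "(p xb \<longlongrightarrow> l) (at_right 0)" "(q xb \<longlongrightarrow> u) (at_right 0)"
    unfolding p_def q_def using conv[THEN convex_on_directional_derivative_exists] by blast
  obtain r B where "r > 0"
    "\<And>y. y \<in> ball xb r \<Longrightarrow> \<bar>lower (F y) - lower (F xb)\<bar> \<le> B"
    "\<And>y. y \<in> ball xb r \<Longrightarrow> \<bar>upper (F y) - upper (F xb)\<bar> \<le> B"
    using gH_Lipschitz_at_endpoints_bounded[OF assms(3)] by blast
  then have cont: "\<forall>\<^sub>F t in at_right 0. isCont (\<lambda>x. p x t) xb"
    "\<forall>\<^sub>F t in at_right 0. isCont (\<lambda>x. q x t) xb"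
    unfolding p_def q_def
    using conv(1)[THEN convex_on_quotient_isCont] conv(2)[THEN convex_on_quotient_isCont] by blast+
  \<comment> \<open>The limits \<open>l\<close> and \<open>u\<close> may come in either order, so
    they are sorted; minimum and maximum commute with the limit.\<close>
  define L where "L = Interval (min l u, max l u)"
  have L: "lower L = min l u" "upper L = max l u"
    by (simp_all add: L_def lower_Interval upper_Interval)
  have quot: "lower (gH_quotient F h x t) = min (p x t) (q x t)"
    "upper (gH_quotient F h x t) = max (p x t) (q x t)" if "t > 0" for x t
    using that by (simp_all add: lower_gH_quotient upper_gH_quotient p_def q_def)
  have lim_min: "((\<lambda>t. min (p xb t) (q xb t)) \<longlongrightarrow> min l u) (at_right 0)"
    and lim_max: "((\<lambda>t. max (p xb t) (q xb t)) \<longlongrightarrow> max l u) (at_right 0)"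
    by (intro tendsto_min tendsto_max lim)+
  have pos: "\<forall>\<^sub>F t in at_right (0::real). t > 0"
    by (rule eventually_at_right_less)
  have dir_lower: "((\<lambda>t. lower (gH_quotient F h xb t)) \<longlongrightarrow> min l u) (at_right 0)"
    by (rule Lim_transform_eventually[OF lim_min]) (use pos in \<open>eventually_elim, simp add: quot\<close>)
  have dir_upper: "((\<lambda>t. upper (gH_quotient F h xb t)) \<longlongrightarrow> max l u) (at_right 0)"
    by (rule Lim_transform_eventually[OF lim_max]) (use pos in \<open>eventually_elim, simp add: quot\<close>)
  have "min (p x t) (q x t) \<le> min (p x s) (q x s)" if "0 < t" "t \<le> s" for x t s
    using that by (intro min.mono mono_onD[OF mono(1)] mono_onD[OF mono(2)]) auto
  then have mono_lower: "mono_on {0<..} (\<lambda>t. lower (gH_quotient F h x t))" for x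
    by (intro mono_onI) (simp only: quot greaterThan_iff)
  have "max (p x t) (q x t) \<le> max (p x s) (q x s)" if "0 < t" "t \<le> s" for x t s
    using that by (intro max.mono mono_onD[OF mono(1)] mono_onD[OF mono(2)]) auto
  then have mono_upper: "mono_on {0<..} (\<lambda>t. upper (gH_quotient F h x t))" for x
    by (intro mono_onI) (simp only: quot greaterThan_iff)
  have cont_lower: "\<forall>\<^sub>F t in at_right 0. isCont (\<lambda>x. lower (gH_quotient F h x t)) xb"
    using cont pos by eventually_elim (auto simp: quot intro: continuous_min)
  have cont_upper: "\<forall>\<^sub>F t in at_right 0. isCont (\<lambda>x. upper (gH_quotient F h x t)) xb"
    using cont pos by eventually_elim (auto simp: quot intro: continuous_max)
  have "has_upper_gH_Clarke_derivative F xb h L"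
    unfolding has_upper_gH_Clarke_derivative_def L
    using tendsto_SUP_mono_quotient[OF assms(1) mono_lower cont_lower dir_lower]
      tendsto_SUP_mono_quotient[OF assms(1) mono_upper cont_upper dir_upper] by simp
  moreover have "has_gH_directional_derivative F xb h L"
    unfolding has_gH_directional_derivative_def L using dir_lower dir_upper by simp
  ultimately show "\<exists>L. has_upper_gH_Clarke_derivative F xb h L \<and>
      has_gH_directional_derivative F xb h L"
    by blast
qed

end
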